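(* Let $\mathbb{T}$ be a time scale, $a,b\in\mathbb{T}$ with $a<b$, $t\in(a,b]_{\mathbb{T}}$, and $0\le\alpha\le 1$. Let $w,f,g\in C([a,b]_{\mathbb{T}},\mathbb{R})$ be diamond-$\alpha$ integrable functions and let $K:[a,b]_{\mathbb{T}}\times[a,b]_{\mathbb{T}}\to[0,\infty)$ be a nonnegative kernel. Assume that all the integrals appearing below exist and are finite. Let $p,q>1$ with $\frac1p+\frac1q=1$. Assume that \[ \mathcal{I}_{K}^{\alpha}(|w|)(t)=1, \] and that there exist constants $m,M,n,N>0$ such that \[ 0<m\leq|f(s)|\leq M<\infty,\qquad 0<n\leq|g(s)|\leq N<\infty \] for all $s\in[a,t]_{\mathbb{T}}$. Then \[ \begin{aligned} 0&\leq\Big[\mathcal{I}_{K}^{\alpha}(|w||f|^p)(t)\Big]^{1/p}\Big[\mathcal{I}_{K}^{\alpha}(|w||g|^q)(t)\Big]^{1/q}-\mathcal{I}_{K}^{\alpha}(|w||f||g|)(t)\\ &\leq\gamma\Lambda^2\Big[\mathcal{I}_{K}^{\alpha}(|w||f|^p)(t)\Big]^{1/p}\Big[\mathcal{I}_{K}^{\alpha}(|w||g|^q)(t)\Big]^{1/q}, \end{aligned} \] where $\gamma=\max\{\frac1p,\frac1q\}$ and \[ \Lambda=\max\left\{\left(\frac{M}{m}\right)^{p/2},\left(\frac{N}{n}\right)^{q/2}\right\}-\min\left\{\left(\frac{m}{M}\right)^{p/2},\left(\frac{n}{N}\right)^{q/2}\right\}. \]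
   Context: A time scale $\mathbb{T}$ is a nonempty closed subset of $\mathbb{R}$. For $a,b\in\mathbb{T}$, $[a,b]_{\mathbb{T}}=[a,b]\cap\mathbb{T}$ and $(a,b]_{\mathbb{T}}=(a,b]\cap\mathbb{T}$. For $0\le\alpha\le1$ and $h$ delta and nabla integrable on $[a,b]_{\mathbb{T}}$, the diamond-$\alpha$ integral is \[ \int_a^b h(s)\diamond_\alpha s=\alpha\int_a^b h(s)\,\Delta s+(1-\alpha)\int_a^b h(s)\,\nabla s, \] where $\int\cdot\,\Delta s$ and $\int\cdot\,\nabla s$ are the usual delta and nabla integrals of time scale calculus. For a nonnegative kernel $K:[a,b]_{\mathbb{T}}\times[a,b]_{\mathbb{T}}\to[0,\infty)$ and a suitable function $h:[a,b]_{\mathbb{T}}\to\mathbb{R}$, the kernel-type diamond-$\alpha$ integral operator is \[ \mathcal{I}_{K}^{\alpha}h(t)=\int_a^t K(t,s)h(s)\diamond_\alpha s, \] provided that the integral exists and is finite. An expression such as $|w||f|^p$ denotes the function $s\mapsto|w(s)||f(s)|^p$. *)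

theory Defs
  imports "HOL-Analysis.Analysis"
begin

definition time_scale :: "real set \<Rightarrow> bool" where
  "time_scale T \<longleftrightarrow> T \<noteq> {} \<and> closed T"

text \<open>
  The delta and nabla integrals are taken in the sense of Lebesgue: the delta measure is the
  completion of the Caratheodory extension of the length function on the half-open intervals
  \<open>[c,d)\<close> of the time scale, the nabla measure that of the length function on the intervals
  \<open>(c,d]\<close>. The extension is unique apart from the value it gives to the singleton of a
  largest (delta) or smallest (nabla) element of \<open>T\<close>, which the integrals below never see.
\<close>

definition delta_measure :: "real set \<Rightarrow> real measure" where
  "delta_measure T = completion (extend_measure T {(c, d). c \<in> T \<and> d \<in> T \<and> c \<le> d}
     (\<lambda>(c, d). {c..<d} \<inter> T) (\<lambda>(c, d). ennreal (d - c)))"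

definition nabla_measure :: "real set \<Rightarrow> real measure" where
  "nabla_measure T = completion (extend_measure T {(c, d). c \<in> T \<and> d \<in> T \<and> c \<le> d}
     (\<lambda>(c, d). {c<..d} \<inter> T) (\<lambda>(c, d). ennreal (d - c)))"

text \<open>
  The integrals from \<open>a\<close> to \<open>b\<close> are meant for \<open>a \<le> b\<close>. The delta integral ranges over
  \<open>[a,b)\<close> and the nabla integral over \<open>(a,b]\<close>, so that a right-scattered point \<open>s\<close> in
  \<open>[a,b)\<close> contributes its graininess to the former and a left-scattered point in \<open>(a,b]\<close>
  its backward graininess to the latter.
\<close>

definition delta_integrable :: "real set \<Rightarrow> real \<Rightarrow> real \<Rightarrow> (real \<Rightarrow> real) \<Rightarrow> bool" where
  "delta_integrable T a b h \<longleftrightarrow> set_integrable (delta_measure T) ({a..<b} \<inter> T) h"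

definition delta_integral :: "real set \<Rightarrow> real \<Rightarrow> real \<Rightarrow> (real \<Rightarrow> real) \<Rightarrow> real" where
  "delta_integral T a b h = set_lebesgue_integral (delta_measure T) ({a..<b} \<inter> T) h"

definition nabla_integrable :: "real set \<Rightarrow> real \<Rightarrow> real \<Rightarrow> (real \<Rightarrow> real) \<Rightarrow> bool" where
  "nabla_integrable T a b h \<longleftrightarrow> set_integrable (nabla_measure T) ({a<..b} \<inter> T) h"

definition nabla_integral :: "real set \<Rightarrow> real \<Rightarrow> real \<Rightarrow> (real \<Rightarrow> real) \<Rightarrow> real" where
  "nabla_integral T a b h = set_lebesgue_integral (nabla_measure T) ({a<..b} \<inter> T) h"

text \<open>Existence of the diamond integral requires both integrals for every \<open>\<alpha>\<close>,
  also for \<open>\<alpha> = 0\<close> and \<open>\<alpha> = 1\<close>.\<close>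

definition diamond_integrable :: "real set \<Rightarrow> real \<Rightarrow> real \<Rightarrow> (real \<Rightarrow> real) \<Rightarrow> bool" where
  "diamond_integrable T a b h \<longleftrightarrow> delta_integrable T a b h \<and> nabla_integrable T a b h"

definition diamond_integral ::
    "real set \<Rightarrow> real \<Rightarrow> real \<Rightarrow> real \<Rightarrow> (real \<Rightarrow> real) \<Rightarrow> real" where
  "diamond_integral T \<alpha> a b h = \<alpha> * delta_integral T a b h + (1 - \<alpha>) * nabla_integral T a b h"

definition kernel_op_exists ::
    "real set \<Rightarrow> (real \<Rightarrow> real \<Rightarrow> real) \<Rightarrow> real \<Rightarrow> (real \<Rightarrow> real) \<Rightarrow> real \<Rightarrow> bool" where
  "kernel_op_exists T K a h t \<longleftrightarrow> diamond_integrable T a t (\<lambda>s. K t s * h s)"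

definition kernel_op ::
    "real set \<Rightarrow> real \<Rightarrow> (real \<Rightarrow> real \<Rightarrow> real) \<Rightarrow> real \<Rightarrow> (real \<Rightarrow> real) \<Rightarrow> real \<Rightarrow> real" where
  "kernel_op T \<alpha> K a h t = diamond_integral T \<alpha> a t (\<lambda>s. K t s * h s)"

text \<open>
  The following facts show that \<^const>\<open>extend_measure\<close> does not fall back to the zero measure:
  the extensions are realized by the images of Lebesgue measure under
  \<open>x \<mapsto> sup {s \<in> T. s \<le> x}\<close> and \<open>x \<mapsto> inf {s \<in> T. x \<le> s}\<close>.
\<close>

lemma emeasure_extend_via_mono:
  fixes T S :: "real set" and \<pi> :: "real \<Rightarrow> real"
  assumes T: "T \<in> sets borel" and S: "S \<in> sets borel" and mono: "mono_on S \<pi>"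
    and G: "\<And>c d. c \<in> T \<Longrightarrow> d \<in> T \<Longrightarrow> c \<le> d \<Longrightarrow>
              G c d \<in> sets borel \<and> G c d \<subseteq> T \<and> emeasure lborel (\<pi> -` G c d \<inter> S) = ennreal (d - c)"
    and cd: "c \<in> T" "d \<in> T" "c \<le> d"
  shows "emeasure (completion (extend_measure T {(c, d). c \<in> T \<and> d \<in> T \<and> c \<le> d}
           (\<lambda>(c, d). G c d) (\<lambda>(c, d). ennreal (d - c)))) (G c d) = ennreal (d - c)"
proof -
  let ?I = "{(c, d). c \<in> T \<and> d \<in> T \<and> c \<le> d}"
  define M where "M = extend_measure T ?I (\<lambda>(c, d). G c d) (\<lambda>(c, d). ennreal (d - c))"
  define N where "N = distr (restrict_space lborel S) borel \<pi>"
  have sets_eq: "sets (restrict_space lborel S) = sets (restrict_space borel S)"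
    by (simp add: sets_restrict_space)
  have meas: "\<pi> \<in> measurable (restrict_space lborel S) borel"
    using borel_measurable_mono_on_fnc[OF mono] measurable_cong_sets[OF sets_eq refl] by blast
  have N: "emeasure N A = emeasure lborel (\<pi> -` A \<inter> S)" if "A \<in> sets borel" for A
  proof -
    have "emeasure N A = emeasure (restrict_space lborel S) (\<pi> -` A \<inter> S)"
      unfolding N_def using emeasure_distr[OF meas that] by (simp add: space_restrict_space)
    also have "\<dots> = emeasure lborel (\<pi> -` A \<inter> S)"
      using S by (intro emeasure_restrict_space) auto
    finally show ?thesis .
  qed
  have GI: "(\<lambda>(c, d). G c d) ` ?I \<subseteq> Pow T"
    using G by fastforce
  have setsM: "sets M = sigma_sets T ((\<lambda>(c, d). G c d) ` ?I)"
    unfolding M_def by (rule sets_extend_measure[OF GI])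
  have sub: "sets M \<subseteq> sets N"
  proof
    fix A assume "A \<in> sets M"
    then have "A \<in> sigma_sets T ((\<lambda>(c, d). G c d) ` ?I)" by (simp add: setsM)
    then show "A \<in> sets N"
    proof induction
      case (Basic A)
      then show ?case using G by (auto simp: N_def)
    qed (use T in \<open>auto simp: N_def\<close>)
  qed
  have pos: "positive (sets M) (emeasure N)"
    by (simp add: positive_def)
  have add: "countably_additive (sets M) (emeasure N)"
    using sub by (auto simp: countably_additive_def intro!: suminf_emeasure)
  have "emeasure M (case (c, d) of (c, d) \<Rightarrow> G c d) = (case (c, d) of (c, d) \<Rightarrow> ennreal (d - c))"
    by (rule emeasure_extend_measure[OF M_def _ GI pos add]) (use G N cd in auto)
  moreover have "G c d \<in> sets M"
    unfolding setsM using cd by (intro sigma_sets.Basic) auto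
  ultimately show ?thesis
    unfolding M_def[symmetric] by simp
qed

lemma emeasure_delta_measure:
  assumes "time_scale T" "c \<in> T" "d \<in> T" "c \<le> d"
  shows "emeasure (delta_measure T) ({c..<d} \<inter> T) = ennreal (d - c)"
proof -
  have cl: "closed T" using assms by (simp add: time_scale_def)
  define S where "S = {x. \<exists>s\<in>T. s \<le> x}"
  define \<pi> where "\<pi> x = Sup (T \<inter> {..x})" for x
  have bdd: "bdd_above (T \<inter> {..x})" for x by (rule bdd_aboveI[of _ x]) auto
  have in_T: "\<pi> x \<in> T" "\<pi> x \<le> x" if "x \<in> S" for x
    using closed_contains_Sup[of "T \<inter> {..x}"] bdd cl that by (auto simp: S_def \<pi>_def)
  have up: "s \<le> \<pi> x" if "s \<in> T" "s \<le> x" for s x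
    unfolding \<pi>_def using that bdd by (intro cSup_upper) auto
  have mono: "mono_on S \<pi>"
    by (intro mono_onI up in_T) (auto dest: in_T)
  have "is_interval S"
    unfolding S_def is_interval_1 by (blast intro: order.trans)
  then have S: "S \<in> sets borel"
    by (rule real_interval_borel_measurable)
  have vim: "\<pi> -` ({c..<d} \<inter> T) \<inter> S = {c..<d}" if "c \<in> T" "d \<in> T" for c d
  proof (intro equalityI subsetI)
    fix x assume "x \<in> \<pi> -` ({c..<d} \<inter> T) \<inter> S"
    then show "x \<in> {c..<d}"
      using in_T(2)[of x] up[OF that(2), of x] by (cases "d \<le> x") auto
  next
    fix x assume x: "x \<in> {c..<d}"
    then have "x \<in> S" using that by (auto simp: S_def)
    then show "x \<in> \<pi> -` ({c..<d} \<inter> T) \<inter> S"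
      using in_T[of x] up[OF that(1), of x] x by auto
  qed
  show ?thesis
    unfolding delta_measure_def
    by (rule emeasure_extend_via_mono[OF _ S mono]) (use cl assms vim in auto)
qed

lemma emeasure_nabla_measure:
  assumes "time_scale T" "c \<in> T" "d \<in> T" "c \<le> d"
  shows "emeasure (nabla_measure T) ({c<..d} \<inter> T) = ennreal (d - c)"
proof -
  have cl: "closed T" using assms by (simp add: time_scale_def)
  define S where "S = {x. \<exists>s\<in>T. x \<le> s}"
  define \<pi> where "\<pi> x = Inf (T \<inter> {x..})" for x
  have bdd: "bdd_below (T \<inter> {x..})" for x by (rule bdd_belowI[of _ x]) auto
  have in_T: "\<pi> x \<in> T" "x \<le> \<pi> x" if "x \<in> S" for x
    using closed_contains_Inf[of "T \<inter> {x..}"] bdd cl that by (auto simp: S_def \<pi>_def)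
  have low: "\<pi> x \<le> s" if "s \<in> T" "x \<le> s" for s x
    unfolding \<pi>_def using that bdd by (intro cInf_lower) auto
  have mono: "mono_on S \<pi>"
    by (intro mono_onI low in_T) (auto intro: order.trans dest: in_T)
  have "is_interval S"
    unfolding S_def is_interval_1 by (blast intro: order.trans)
  then have S: "S \<in> sets borel"
    by (rule real_interval_borel_measurable)
  have vim: "\<pi> -` ({c<..d} \<inter> T) \<inter> S = {c<..d}" if "c \<in> T" "d \<in> T" for c d
  proof (intro equalityI subsetI)
    fix x assume "x \<in> \<pi> -` ({c<..d} \<inter> T) \<inter> S"
    then show "x \<in> {c<..d}"
      using in_T(2)[of x] low[OF that(1), of x] by (cases "x \<le> c") auto
  next
    fix x assume x: "x \<in> {c<..d}"
    then have "x \<in> S" using that by (auto simp: S_def)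
    then show "x \<in> \<pi> -` ({c<..d} \<inter> T) \<inter> S"
      using in_T[of x] low[OF that(2), of x] x by auto
  qed
  show ?thesis
    unfolding nabla_measure_def
    by (rule emeasure_extend_via_mono[OF _ S mono]) (use cl assms vim in auto)
qed

end

theory Submission
  imports Defs
begin

text \<open>
  Put \<open>F = I(|w||f|\<^sup>p)\<close>, \<open>G = I(|w||g|\<^sup>q)\<close>, \<open>x = |f|\<^sup>p / F\<close> and \<open>y = |g|\<^sup>q / G\<close>. The mean value of \<open>x / p + y / q\<close>
  against the weight is 1, and the pointwise gap in Young's inequality
  \<open>x\<^bsup>1/p\<^esup> y\<^bsup>1/q\<^esup> \<le> x / p + y / q\<close> is at most \<open>\<gamma> (\<surd>x - \<surd>y)\<^sup>2\<close> (Kittaneh and Manasrah). As the weight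
  has total mass 1, \<open>F\<close> lies between \<open>m\<^sup>p\<close> and \<open>M\<^sup>p\<close>, and \<open>G\<close> likewise, so that \<open>|\<surd>x - \<surd>y| \<le> \<Lambda>\<close>.
  Integrating the two pointwise inequalities gives the claim.
\<close>

lemma diamond_integrable_add:
  assumes "diamond_integrable T a t h" "diamond_integrable T a t k"
  shows "diamond_integrable T a t (\<lambda>s. h s + k s)"
  using assms unfolding diamond_integrable_def delta_integrable_def nabla_integrable_def
  by (auto intro: set_integral_add(1))

lemma diamond_integral_add:
  assumes "diamond_integrable T a t h" "diamond_integrable T a t k"
  shows "diamond_integral T \<alpha> a t (\<lambda>s. h s + k s) = diamond_integral T \<alpha> a t h + diamond_integral T \<alpha> a t k"
  using assms unfolding diamond_integrable_def delta_integrable_def nabla_integrable_def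
    diamond_integral_def delta_integral_def nabla_integral_def
  by (simp add: set_integral_add(2) algebra_simps)

text \<open>Both coefficients \<open>\<alpha>\<close> and \<open>1 - \<alpha>\<close> are
  nonnegative, and the pointwise comparison on \<open>{a..t} \<inter> T\<close> covers the delta
  range \<open>{a..<t} \<inter> T\<close> as well as the nabla range
  \<open>{a<..t} \<inter> T\<close>.\<close>

lemma diamond_integral_mono:
  assumes "0 \<le> \<alpha>" "\<alpha> \<le> 1"
    and "diamond_integrable T a t h" "diamond_integrable T a t k"
    and "\<And>s. s \<in> {a..t} \<inter> T \<Longrightarrow> h s \<le> k s"
  shows "diamond_integral T \<alpha> a t h \<le> diamond_integral T \<alpha> a t k"
  using assms unfolding diamond_integrable_def delta_integrable_def nabla_integrable_def
    diamond_integral_def delta_integral_def nabla_integral_def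
  by (intro add_mono mult_left_mono set_integral_mono) auto

lemma kernel_op_exists_add:
  assumes "kernel_op_exists T K a h t" "kernel_op_exists T K a k t"
  shows "kernel_op_exists T K a (\<lambda>s. h s + k s) t"
  using diamond_integrable_add assms unfolding kernel_op_exists_def by (simp add: distrib_left)

lemma kernel_op_add:
  assumes "kernel_op_exists T K a h t" "kernel_op_exists T K a k t"
  shows "kernel_op T \<alpha> K a (\<lambda>s. h s + k s) t = kernel_op T \<alpha> K a h t + kernel_op T \<alpha> K a k t"
  using diamond_integral_add assms unfolding kernel_op_exists_def kernel_op_def
  by (simp add: distrib_left)

lemma kernel_op_exists_cmult:
  assumes "kernel_op_exists T K a h t"
  shows "kernel_op_exists T K a (\<lambda>s. c * h s) t"
  using assms
  unfolding kernel_op_exists_def diamond_integrable_def delta_integrable_def nabla_integrable_def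
  by (simp only: mult.left_commute[of _ c]) (auto intro: set_integrable_mult_right)

text \<open>The identity covers divergent integrals too: a non-integrable function has integral 0 by
  convention, and a nonzero factor \<open>c\<close> keeps it non-integrable.\<close>

lemma kernel_op_cmult: "kernel_op T \<alpha> K a (\<lambda>s. c * h s) t = c * kernel_op T \<alpha> K a h t"
  unfolding kernel_op_def diamond_integral_def delta_integral_def nabla_integral_def
  by (simp only: mult.left_commute[of _ c] set_integral_mult_right distrib_left)

lemma kernel_op_mono:
  assumes "0 \<le> \<alpha>" "\<alpha> \<le> 1"
    and "kernel_op_exists T K a h t" "kernel_op_exists T K a k t"
    and "\<And>s. s \<in> {a..t} \<inter> T \<Longrightarrow> 0 \<le> K t s"
    and "\<And>s. s \<in> {a..t} \<inter> T \<Longrightarrow> h s \<le> k s"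
  shows "kernel_op T \<alpha> K a h t \<le> kernel_op T \<alpha> K a k t"
  using assms unfolding kernel_op_exists_def kernel_op_def
  by (intro diamond_integral_mono mult_left_mono) auto

text \<open>The weight \<open>v\<close> has total mass 1, so the integrals of \<open>c * v s\<close>
  and \<open>d * v s\<close> are \<open>c\<close> and \<open>d\<close>, and \<open>v s * h s\<close>
  lies between these two integrands. This places \<open>F\<close> and \<open>G\<close> of the main
  proof between the extreme values of the averaged powers.\<close>

lemma kernel_op_weighted_mean_bounds:
  assumes "0 \<le> \<alpha>" "\<alpha> \<le> 1"
    and "kernel_op_exists T K a v t" "kernel_op_exists T K a (\<lambda>s. v s * h s) t"
    and "kernel_op T \<alpha> K a v t = 1"
    and "\<And>s. s \<in> {a..t} \<inter> T \<Longrightarrow> 0 \<le> K t s" "\<And>s. s \<in> {a..t} \<inter> T \<Longrightarrow> 0 \<le> v s"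
    and "\<And>s. s \<in> {a..t} \<inter> T \<Longrightarrow> c \<le> h s \<and> h s \<le> d"
  shows "c \<le> kernel_op T \<alpha> K a (\<lambda>s. v s * h s) t \<and> kernel_op T \<alpha> K a (\<lambda>s. v s * h s) t \<le> d"
proof -
  have "kernel_op T \<alpha> K a (\<lambda>s. c * v s) t \<le> kernel_op T \<alpha> K a (\<lambda>s. v s * h s) t"
    using assms by (intro kernel_op_mono kernel_op_exists_cmult)
      (auto simp: mult.commute[of c] intro: mult_left_mono)
  moreover have "kernel_op T \<alpha> K a (\<lambda>s. v s * h s) t \<le> kernel_op T \<alpha> K a (\<lambda>s. d * v s) t"
    using assms by (intro kernel_op_mono kernel_op_exists_cmult)
      (auto simp: mult.commute[of d] intro: mult_left_mono)
  ultimately show ?thesis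
    using assms(5) by (simp add: kernel_op_cmult)
qed

text \<open>Expanding the square reduces the claim to
  \<open>2 * \<nu> * sqrt (x * y) \<le> z + (2 * \<nu> - 1) * y\<close> with
  \<open>z = x powr \<nu> * y powr (1 - \<nu>)\<close>. This is Young's inequality for
  \<open>z\<close> and \<open>y\<close> with weights \<open>1 / (2 * \<nu>)\<close> and
  \<open>1 - 1 / (2 * \<nu>)\<close>; the second weight is nonnegative because
  \<open>1 / 2 \<le> \<nu>\<close>.\<close>

lemma young_gap_le_ge_half:
  fixes x y \<nu> :: real
  assumes "0 < x" "0 < y" "1 / 2 \<le> \<nu>" "\<nu> \<le> 1"
  shows "\<nu> * x + (1 - \<nu>) * y - x powr \<nu> * y powr (1 - \<nu>) \<le> \<nu> * (sqrt x - sqrt y)\<^sup>2"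
proof -
  define z where "z = x powr \<nu> * y powr (1 - \<nu>)"
  have z: "0 < z" using assms by (simp add: z_def)
  \<comment> \<open>The weight \<open>1 / (2 * \<nu>)\<close> is the one that brings the exponent of
    \<open>x\<close> to 1/2; the exponent of \<open>y\<close> then becomes 1/2 as well.\<close>
  have "z powr (1 / (2 * \<nu>)) * y powr (1 - 1 / (2 * \<nu>))
      = x powr (1 / 2) * y powr ((1 - \<nu>) * (1 / (2 * \<nu>)) + (1 - 1 / (2 * \<nu>)))"
    using assms by (simp add: z_def powr_mult powr_powr powr_add)
  also have "(1 - \<nu>) * (1 / (2 * \<nu>)) + (1 - 1 / (2 * \<nu>)) = 1 / 2"
    using assms by (simp add: field_simps)
  finally have "sqrt x * sqrt y \<le> 1 / (2 * \<nu>) * z + (1 - 1 / (2 * \<nu>)) * y"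
    using Youngs_inequality_0[of "1 / (2 * \<nu>)" "1 - 1 / (2 * \<nu>)" z y] assms z
    by (simp add: powr_half_sqrt)
  then have "2 * \<nu> * (sqrt x * sqrt y) \<le> 2 * \<nu> * (1 / (2 * \<nu>) * z + (1 - 1 / (2 * \<nu>)) * y)"
    using assms by (intro mult_left_mono) auto
  also have "\<dots> = z + (2 * \<nu> - 1) * y"
    using assms by (simp add: field_simps)
  finally show ?thesis
    using assms by (simp add: z_def[symmetric] power2_diff algebra_simps)
qed

text \<open>Exchanging \<open>x\<close> and \<open>y\<close> replaces \<open>\<nu>\<close> by
  \<open>1 - \<nu>\<close>, so one of the two orders falls under the case of a weight of at least
  1/2.\<close>

lemma young_gap_le:
  fixes x y \<nu> :: real
  assumes "0 < x" "0 < y" "0 \<le> \<nu>" "\<nu> \<le> 1"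
  shows "\<nu> * x + (1 - \<nu>) * y - x powr \<nu> * y powr (1 - \<nu>)
    \<le> max \<nu> (1 - \<nu>) * (sqrt x - sqrt y)\<^sup>2"
proof (cases "1 / 2 \<le> \<nu>")
  case True
  then show ?thesis using young_gap_le_ge_half[of x y \<nu>] assms by (simp add: max_absorb1)
next
  case False
  then show ?thesis using young_gap_le_ge_half[of y x "1 - \<nu>"] assms
    by (simp add: max_absorb2 power2_commute[of "sqrt y"] algebra_simps)
qed

text \<open>Numerator and denominator both lie in the interval from \<open>m powr p\<close> to
  \<open>M powr p\<close>, which confines their quotient between \<open>(m / M) powr p\<close> and
  \<open>(M / m) powr p\<close>; the square root halves the exponent.\<close>

lemma sqrt_powr_ratio_bounds:
  fixes u F m M p :: real
  assumes "0 < m" "0 < M" "0 < p" "m \<le> u" "u \<le> M" "m powr p \<le> F" "F \<le> M powr p"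
  shows "(m / M) powr (p / 2) \<le> sqrt (u powr p / F) \<and> sqrt (u powr p / F) \<le> (M / m) powr (p / 2)"
proof -
  have F: "0 < F" using assms by (intro less_le_trans[OF _ assms(6)]) auto
  have half: "r powr (p / 2) = sqrt (r powr p)" if "0 < r" for r
    using that by (simp add: powr_half_sqrt[symmetric] powr_powr)
  have "m powr p / M powr p \<le> u powr p / F" "u powr p / F \<le> M powr p / m powr p"
    using assms F by (intro frac_le powr_mono2; simp)+
  then have "(m / M) powr p \<le> u powr p / F" "u powr p / F \<le> (M / m) powr p"
    using assms by (simp_all only: powr_divide)
  then show ?thesis
    using assms by (simp add: half)
qed

theorem theorem3p10:
  fixes T :: "real set" and a b t \<alpha> p q m M n N \<gamma> \<Lambda> :: real
    and w f g :: "real \<Rightarrow> real" and K :: "real \<Rightarrow> real \<Rightarrow> real"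
  assumes "time_scale T"
    and "a \<in> T" "b \<in> T" "a < b"
    and "t \<in> {a<..b} \<inter> T"
    and "0 \<le> \<alpha>" "\<alpha> \<le> 1"
    and "continuous_on ({a..b} \<inter> T) w" "continuous_on ({a..b} \<inter> T) f"
      "continuous_on ({a..b} \<inter> T) g"
    and "diamond_integrable T a b w" "diamond_integrable T a b f" "diamond_integrable T a b g"
    and "\<And>x s. x \<in> {a..b} \<inter> T \<Longrightarrow> s \<in> {a..b} \<inter> T \<Longrightarrow> 0 \<le> K x s"
    and "kernel_op_exists T K a (\<lambda>s. \<bar>w s\<bar>) t"
    and "kernel_op_exists T K a (\<lambda>s. \<bar>w s\<bar> * \<bar>f s\<bar> powr p) t"
    and "kernel_op_exists T K a (\<lambda>s. \<bar>w s\<bar> * \<bar>g s\<bar> powr q) t"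
    and "kernel_op_exists T K a (\<lambda>s. \<bar>w s\<bar> * \<bar>f s\<bar> * \<bar>g s\<bar>) t"
    and "p > 1" "q > 1" "1 / p + 1 / q = 1"
    and "kernel_op T \<alpha> K a (\<lambda>s. \<bar>w s\<bar>) t = 1"
    and "m > 0" "M > 0" "n > 0" "N > 0"
    and "\<And>s. s \<in> {a..t} \<inter> T \<Longrightarrow> m \<le> \<bar>f s\<bar> \<and> \<bar>f s\<bar> \<le> M"
    and "\<And>s. s \<in> {a..t} \<inter> T \<Longrightarrow> n \<le> \<bar>g s\<bar> \<and> \<bar>g s\<bar> \<le> N"
    and "\<gamma> = max (1 / p) (1 / q)"
    and "\<Lambda> = max ((M / m) powr (p / 2)) ((N / n) powr (q / 2))
            - min ((m / M) powr (p / 2)) ((n / N) powr (q / 2))"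
  shows "let A = kernel_op T \<alpha> K a (\<lambda>s. \<bar>w s\<bar> * \<bar>f s\<bar> powr p) t powr (1 / p);
             B = kernel_op T \<alpha> K a (\<lambda>s. \<bar>w s\<bar> * \<bar>g s\<bar> powr q) t powr (1 / q);
             C = kernel_op T \<alpha> K a (\<lambda>s. \<bar>w s\<bar> * \<bar>f s\<bar> * \<bar>g s\<bar>) t
         in 0 \<le> A * B - C \<and> A * B - C \<le> \<gamma> * \<Lambda>\<^sup>2 * A * B"
proof -
  define I where "I h = kernel_op T \<alpha> K a h t" for h
  define F where "F = I (\<lambda>s. \<bar>w s\<bar> * \<bar>f s\<bar> powr p)"
  define G where "G = I (\<lambda>s. \<bar>w s\<bar> * \<bar>g s\<bar> powr q)"
  define C where "C = I (\<lambda>s. \<bar>w s\<bar> * \<bar>f s\<bar> * \<bar>g s\<bar>)"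
  define A where "A = F powr (1 / p)"
  define B where "B = G powr (1 / q)"
  note ex = assms(15-18)
  note I1 = assms(22)
  note pq = \<open>p > 1\<close> \<open>q > 1\<close> \<open>1 / p + 1 / q = 1\<close>
  note fb = assms(27) and gb = assms(28)
  have K: "0 \<le> K t s" if "s \<in> {a..t} \<inter> T" for s
    using assms(5,14) that by auto
  have F: "m powr p \<le> F \<and> F \<le> M powr p" unfolding F_def I_def
    using K fb pq \<open>m > 0\<close> by (intro kernel_op_weighted_mean_bounds assms(6,7) ex I1) (auto intro!: powr_mono2)
  have G: "n powr q \<le> G \<and> G \<le> N powr q" unfolding G_def I_def
    using K gb pq \<open>n > 0\<close> by (intro kernel_op_weighted_mean_bounds assms(6,7) ex I1) (auto intro!: powr_mono2)
  have pos: "0 < F" "0 < G"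
    using F G \<open>m > 0\<close> \<open>n > 0\<close> by (auto intro: less_le_trans[of 0 "m powr p"] less_le_trans[of 0 "n powr q"])
  then have AB: "0 < A" "0 < B" by (auto simp: A_def B_def)

  \<comment> \<open>These are the arithmetic and geometric sides of Young's inequality for the
    normalized powers, multiplied by the weight. Writing them as combinations of the given
    integrands yields existence and value of their integrals by linearity.\<close>
  define mean where "mean s = 1 / (p * F) * (\<bar>w s\<bar> * \<bar>f s\<bar> powr p) + 1 / (q * G) * (\<bar>w s\<bar> * \<bar>g s\<bar> powr q)" for s
  define geo where "geo s = 1 / (A * B) * (\<bar>w s\<bar> * \<bar>f s\<bar> * \<bar>g s\<bar>)" for s
  have ex': "kernel_op_exists T K a mean t" "kernel_op_exists T K a geo t"
    "kernel_op_exists T K a (\<lambda>s. geo s + \<gamma> * \<Lambda>\<^sup>2 * \<bar>w s\<bar>) t"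
    unfolding mean_def geo_def by (intro kernel_op_exists_add kernel_op_exists_cmult ex)+
  \<comment> \<open>Dividing by \<open>F\<close> and \<open>G\<close> makes the two terms integrate
    to \<open>1 / p\<close> and \<open>1 / q\<close>, whose sum is 1.\<close>
  have "I mean = 1 / (p * F) * F + 1 / (q * G) * G"
    unfolding I_def mean_def
    by (simp only: kernel_op_add kernel_op_exists_cmult kernel_op_cmult ex F_def G_def I_def)
  then have Imean: "I mean = 1"
    using pos pq by simp
  have Igeo: "I geo = C / (A * B)"
    unfolding I_def geo_def C_def by (simp only: kernel_op_cmult) simp
  have Iub: "I (\<lambda>s. geo s + \<gamma> * \<Lambda>\<^sup>2 * \<bar>w s\<bar>) = C / (A * B) + \<gamma> * \<Lambda>\<^sup>2"
    unfolding Igeo[symmetric] I_def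
    by (simp only: kernel_op_add kernel_op_exists_cmult kernel_op_cmult ex ex' I1 mult_1_right)

  have pointwise: "geo s \<le> mean s \<and> mean s \<le> geo s + \<gamma> * \<Lambda>\<^sup>2 * \<bar>w s\<bar>" if s: "s \<in> {a..t} \<inter> T" for s
  proof -
    define x where "x = \<bar>f s\<bar> powr p / F"
    define y where "y = \<bar>g s\<bar> powr q / G"
    have fg: "0 < \<bar>f s\<bar>" "0 < \<bar>g s\<bar>" using fb[OF s] gb[OF s] \<open>m > 0\<close> \<open>n > 0\<close> by linarith+
    then have xy: "0 < x" "0 < y" using pos by (simp_all add: x_def y_def)
    have q: "1 / q = 1 - 1 / p" using pq by linarith
    have prod: "x powr (1 / p) * y powr (1 / q) = \<bar>f s\<bar> * \<bar>g s\<bar> / (A * B)"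
      using fg pos pq by (simp add: x_def y_def A_def B_def powr_divide powr_powr)
    have geo: "geo s = \<bar>w s\<bar> * (x powr (1 / p) * y powr (1 / q))"
      unfolding prod geo_def by simp
    have mean: "mean s = \<bar>w s\<bar> * (1 / p * x + 1 / q * y)"
      by (simp add: mean_def x_def y_def algebra_simps)
    have sx: "(m / M) powr (p / 2) \<le> sqrt x \<and> sqrt x \<le> (M / m) powr (p / 2)"
      unfolding x_def using F fb[OF s] pq \<open>m > 0\<close> \<open>M > 0\<close> by (intro sqrt_powr_ratio_bounds) auto
    have sy: "(n / N) powr (q / 2) \<le> sqrt y \<and> sqrt y \<le> (N / n) powr (q / 2)"
      unfolding y_def using G gb[OF s] pq \<open>n > 0\<close> \<open>N > 0\<close> by (intro sqrt_powr_ratio_bounds) auto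
    \<comment> \<open>Both roots lie between the minimum and the maximum whose difference is
      \<open>\<Lambda>\<close>.\<close>
    have "\<bar>sqrt x - sqrt y\<bar> \<le> \<Lambda>"
      using sx sy unfolding assms(30) by linarith
    then have "(sqrt x - sqrt y)\<^sup>2 \<le> \<Lambda>\<^sup>2"
      by (metis abs_ge_zero power2_abs power_mono)
    then have "\<gamma> * (sqrt x - sqrt y)\<^sup>2 \<le> \<gamma> * \<Lambda>\<^sup>2"
      using pq by (intro mult_left_mono) (auto simp: assms(29) le_max_iff_disj)
    \<comment> \<open>This is the gap estimate at \<open>\<nu> = 1 / p\<close>, where
      \<open>1 - \<nu> = 1 / q\<close> and the larger weight is \<open>\<gamma>\<close>.\<close>
    moreover have "1 / p * x + 1 / q * y - x powr (1 / p) * y powr (1 / q) \<le> \<gamma> * (sqrt x - sqrt y)\<^sup>2"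
      using young_gap_le[OF xy, of "1 / p"] pq(1) unfolding assms(29) q by simp
    ultimately have "1 / p * x + 1 / q * y \<le> x powr (1 / p) * y powr (1 / q) + \<gamma> * \<Lambda>\<^sup>2"
      by linarith
    then have "\<bar>w s\<bar> * (1 / p * x + 1 / q * y)
        \<le> \<bar>w s\<bar> * (x powr (1 / p) * y powr (1 / q) + \<gamma> * \<Lambda>\<^sup>2)"
      by (rule mult_left_mono) simp
    then have "mean s \<le> geo s + \<gamma> * \<Lambda>\<^sup>2 * \<bar>w s\<bar>"
      unfolding geo mean by (simp only: distrib_left mult.commute)
    moreover have "geo s \<le> mean s"
      unfolding geo mean using Youngs_inequality_0[of "1 / p" "1 / q" x y] xy pq
      by (intro mult_left_mono) auto
    ultimately show ?thesis by simp
  qed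
  have "I geo \<le> I mean" "I mean \<le> I (\<lambda>s. geo s + \<gamma> * \<Lambda>\<^sup>2 * \<bar>w s\<bar>)"
    unfolding I_def using pointwise K by (auto intro!: kernel_op_mono ex' assms(6,7))
  then have "C / (A * B) \<le> 1" "1 \<le> C / (A * B) + \<gamma> * \<Lambda>\<^sup>2"
    by (simp_all only: Imean Igeo Iub)
  \<comment> \<open>Both normalized inequalities are multiplied by \<open>A * B > 0\<close>.\<close>
  then have "0 \<le> A * B - C \<and> A * B - C \<le> \<gamma> * \<Lambda>\<^sup>2 * A * B"
    using AB by (simp add: field_simps)
  then show ?thesis
    unfolding Let_def A_def B_def C_def F_def G_def I_def .
qed

end
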